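(* Let $S_c=(s_{ij})$ be a real symmetric $n\times n$ matrix with zero diagonal, let $0<\epsilon\ll1$ be a fixed small constant, and for $p>0$ let $$U_c(x)=\sum_{i=1}^n\left(\frac14x_i^4+\frac{1-p}{2}x_i^2\right)-\epsilon\,x^TS_cx,\qquad x\in\mathbb{R}^n.$$ There is an admissible threshold $\alpha_*>0$ for $(\beta,S)=(1,2\epsilon S_c)$ (see context) such that whenever $p>\alpha_*^2$, if $x$ is a global minimum point of $U_c$, then $\operatorname{sgn}(x)$ is a minimizer of the Ising energy $E(v)=-\frac12v^TS_cv$ over $v\in\{-1,1\}^n$.
   Context: $\operatorname{sgn}$ is the componentwise sign. For $\beta>0$ and $S$ real symmetric with zero diagonal, a constant $\alpha_*>0$ is an admissible threshold for $(\beta,S)$ if for every $\alpha>\alpha_*$ the function $U(x)=\sum_{i=1}^n\frac14x_i^4+\frac{\beta-\alpha^2}{2}x^Tx-\frac12x^TSx$ on $\mathbb{R}^n$ has the properties: the signum vectors of its local minimum points form the set $\{-1,1\}^n$, and the signum vector of every global minimum point minimizes $-\frac12v^TSv$ over $\{-1,1\}^n$. *)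

theory Defs
  imports "HOL-Analysis.Analysis"
begin

(* Not the library's sgn on real ^ 'n, which is the normalised vector x /\<^sub>R norm x. *)
definition sgn_vec :: "real ^ 'n \<Rightarrow> real ^ 'n" where
  "sgn_vec x = (\<chi> i. sgn (x $ i))"

definition spin_vectors :: "(real ^ 'n) set" where
  "spin_vectors = {v. \<forall>i. v $ i \<in> {-1, 1}}"

definition ising_energy :: "real ^ 'n ^ 'n \<Rightarrow> real ^ 'n \<Rightarrow> real" where
  "ising_energy S v = - (1/2) * (v \<bullet> (S *v v))"

definition local_min_point :: "('a :: topological_space \<Rightarrow> real) \<Rightarrow> 'a \<Rightarrow> bool" where
  "local_min_point f x \<longleftrightarrow> (\<forall>\<^sub>F y in nhds x. f x \<le> f y)"

definition global_min_point :: "('a \<Rightarrow> real) \<Rightarrow> 'a \<Rightarrow> bool" where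
  "global_min_point f x \<longleftrightarrow> is_arg_min f (\<lambda>_. True) x"

definition potential :: "real \<Rightarrow> real \<Rightarrow> real ^ 'n ^ 'n \<Rightarrow> real ^ 'n \<Rightarrow> real" where
  "potential \<beta> \<alpha> S x =
     (\<Sum>i\<in>UNIV. (1/4) * (x $ i) ^ 4) + (\<beta> - \<alpha>\<^sup>2) / 2 * (x \<bullet> x) - (1/2) * (x \<bullet> (S *v x))"

(* Only meant for \<beta> > 0 and S symmetric with zero diagonal. *)
definition admissible_threshold :: "real \<Rightarrow> real ^ 'n ^ 'n \<Rightarrow> real \<Rightarrow> bool" where
  "admissible_threshold \<beta> S \<alpha>0 \<longleftrightarrow>
     \<alpha>0 > 0 \<and>
     (\<forall>\<alpha>>\<alpha>0.
        sgn_vec ` {x. local_min_point (potential \<beta> \<alpha> S) x} = spin_vectors \<and>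
        (\<forall>x. global_min_point (potential \<beta> \<alpha> S) x \<longrightarrow>
             is_arg_min (ising_energy S) (\<lambda>v. v \<in> spin_vectors) (sgn_vec x)))"

definition potential_c :: "real \<Rightarrow> real \<Rightarrow> real ^ 'n ^ 'n \<Rightarrow> real ^ 'n \<Rightarrow> real" where
  "potential_c \<epsilon> p S x =
     (\<Sum>i\<in>UNIV. (1/4) * (x $ i) ^ 4 + (1 - p) / 2 * (x $ i)\<^sup>2) - \<epsilon> * (x \<bullet> (S *v x))"

end

theory Submission
  imports Defs
begin

text \<open>
  Put \<open>c = \<alpha>\<^sup>2 - \<beta>\<close>. Up to a constant the potential is a sum of double wells
  \<open>(x\<^sub>i\<^sup>2 - c)\<^sup>2 / 4\<close> minus the quadratic form of \<open>S\<close>. As \<open>S\<close> has zero diagonal, the restriction to a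
  coordinate line through a point with \<open>x\<^sub>i = 0\<close> is concave there, so local minima have no zero
  coordinate. In the orthant of a spin vector \<open>s\<close> write \<open>x = \<surd>c s + d\<close>; then
  \<open>U(x) - U(\<surd>c s) \<ge> c/8 |d|\<^sup>2 - K \<surd>c |d|\<close>, with \<open>K\<close> independent of \<open>c\<close>. For large \<open>c\<close> this
  is positive on the sphere \<open>|d| = \<surd>c/2\<close>, which gives a local minimum in every orthant. It is
  also at least \<open>-2 K\<^sup>2\<close>, while the values \<open>U(\<surd>c s)\<close> of spin vectors with different Ising energies
  are separated by a multiple of \<open>c\<close>, which settles the global minima.
\<close>

section \<open>Double-well form of the potential and algebra of the Ising energy\<close>

text \<open>Completing the square in each \<open>(x $ i)\<^sup>2\<close>. The wells vanish at a spin
  vector scaled by \<open>sqrt (\<alpha>\<^sup>2 - \<beta>)\<close>, where only a constant and the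
  Ising energy remain.\<close>

lemma potential_double_well:
  fixes S :: "real ^ 'n ^ 'n"
  shows "potential \<beta> \<alpha> S x =
    (\<Sum>i\<in>UNIV. ((x $ i)\<^sup>2 - (\<alpha>\<^sup>2 - \<beta>))\<^sup>2 / 4) - real CARD('n) * (\<alpha>\<^sup>2 - \<beta>)\<^sup>2 / 4
      + ising_energy S x"
proof -
  have eq: "((x $ i)\<^sup>2 - (\<alpha>\<^sup>2 - \<beta>))\<^sup>2 / 4 =
      (1/4) * (x $ i) ^ 4 + (\<beta> - \<alpha>\<^sup>2) / 2 * (x $ i * x $ i) + (\<alpha>\<^sup>2 - \<beta>)\<^sup>2 / 4" for i
    by (simp add: power2_eq_square power4_eq_xxxx field_simps)
  show ?thesis
    unfolding eq
    by (simp add: potential_def ising_energy_def inner_vec_def sum.distrib sum_distrib_left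
        sum_negf flip: sum_divide_distrib)
qed

lemma ising_energy_add:
  assumes "transpose S = S"
  shows "ising_energy S (x + y) = ising_energy S x + ising_energy S y - x \<bullet> (S *v y)"
proof -
  have "y \<bullet> (S *v x) = x \<bullet> (S *v y)"
    using assms dot_lmul_matrix[of y S x] by (simp add: inner_commute flip: vector_transpose_matrix)
  then show ?thesis
    by (simp add: ising_energy_def matrix_vector_right_distrib inner_add_left inner_add_right field_simps)
qed

lemma ising_energy_scaleR:
  "ising_energy S (r *\<^sub>R x) = r\<^sup>2 * ising_energy S x"
  by (simp add: ising_energy_def matrix_vector_mult_scaleR power2_eq_square)

lemma ising_energy_scaleR_left:
  "ising_energy (a *\<^sub>R S) x = a * ising_energy S x"
  by (simp add: ising_energy_def scaleR_matrix_vector_assoc[symmetric])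

section \<open>Spin vectors\<close>

lemma spin_vectors_iff: "s \<in> spin_vectors \<longleftrightarrow> (\<forall>i. s $ i = 1 \<or> s $ i = -1)"
  by (auto simp: spin_vectors_def)

lemma finite_spin_vectors: "finite (spin_vectors :: (real ^ 'n) set)"
proof (rule finite_subset)
  show "(spin_vectors :: (real ^ 'n) set) \<subseteq> range (\<lambda>A. \<chi> i. if i \<in> A then 1 else (-1 :: real))"
  proof (rule subsetI)
    fix s :: "real ^ 'n" assume "s \<in> spin_vectors"
    then have "s = (\<chi> i. if i \<in> {j. s $ j = 1} then 1 else -1)"
      by (auto simp: spin_vectors_iff vec_eq_iff)
    then show "s \<in> range (\<lambda>A. \<chi> i. if i \<in> A then 1 else -1)" by blast
  qed
qed simp

lemma abs_spin_vector: "s \<in> spin_vectors \<Longrightarrow> \<bar>s $ i\<bar> = 1"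
  unfolding spin_vectors_iff by (metis abs_1 abs_minus_cancel)

lemma spin_vector_square: "s \<in> spin_vectors \<Longrightarrow> (s $ i)\<^sup>2 = 1"
  using abs_spin_vector[of s i] by (metis one_power2 power2_abs)

text \<open>The crude l1 bound is enough: it only enters constants that do not depend on
  \<open>\<alpha>\<close>.\<close>

lemma norm_spin_vector_le:
  fixes s :: "real ^ 'n"
  assumes "s \<in> spin_vectors"
  shows "norm s \<le> real CARD('n)"
proof -
  have "(\<Sum>i\<in>UNIV. \<bar>s $ i\<bar>) = (\<Sum>i\<in>(UNIV::'n set). 1)"
    using assms by (intro sum.cong) (auto simp: abs_spin_vector)
  with norm_le_l1_cart[of s] show ?thesis by simp
qed

lemma sgn_vec_in_spin_vectors:
  assumes "\<And>i. x $ i \<noteq> 0"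
  shows "sgn_vec x \<in> spin_vectors"
  using assms by (auto simp: spin_vectors_iff sgn_vec_def sgn_real_def)

section \<open>Local minima avoid the coordinate hyperplanes\<close>

text \<open>Take a second difference along axis \<open>i\<close>: linear terms cancel, the zero
  diagonal removes the energy of the displacement, and the well at \<open>x $ i = 0\<close> leaves
  \<open>t^4/2 - c * t\<^sup>2\<close>, negative for small \<open>t\<close>.\<close>

lemma local_min_point_coord_nonzero:
  fixes S :: "real ^ 'n ^ 'n"
  assumes diag: "S $ i $ i = 0" and c: "\<alpha>\<^sup>2 > \<beta>"
    and min: "local_min_point (potential \<beta> \<alpha> S) x"
  shows "x $ i \<noteq> 0"
proof
  assume xi: "x $ i = 0"
  define c where "c = \<alpha>\<^sup>2 - \<beta>"
  have "c > 0" using c by (simp add: c_def)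
  obtain d where "d > 0" and d: "\<And>y. dist y x < d \<Longrightarrow> potential \<beta> \<alpha> S x \<le> potential \<beta> \<alpha> S y"
    using min unfolding local_min_point_def eventually_nhds_metric by blast
  \<comment> \<open>The first bound keeps \<open>x + a\<close> and \<open>x - a\<close> inside the
    neighbourhood; the second gives \<open>t^4 \<le> c * t\<^sup>2\<close>, so that the second
    difference is negative.\<close>
  define t where "t = min (d/2) (sqrt c)"
  have t: "t > 0" "t < d" "t \<le> sqrt c"
    using \<open>d > 0\<close> \<open>c > 0\<close> by (auto simp: t_def)
  then have t2: "t\<^sup>2 \<le> c"
    using \<open>c > 0\<close> by (metis less_eq_real_def power_mono real_sqrt_pow2)
  define a where "a = (axis i t :: real ^ 'n)"
  have norm_a: "norm a = t" using t by (simp add: a_def norm_eq_sqrt_inner inner_axis_axis)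
  have "potential \<beta> \<alpha> S x \<le> potential \<beta> \<alpha> S (x + a)" "potential \<beta> \<alpha> S x \<le> potential \<beta> \<alpha> S (x - a)"
    using t norm_a by (auto intro!: d simp: dist_norm)
  moreover have "potential \<beta> \<alpha> S (x + a) + potential \<beta> \<alpha> S (x - a) = 2 * potential \<beta> \<alpha> S x + (t^4/2 - c * t\<^sup>2)"
  proof -
    have "ising_energy S a = 0"
      using diag by (simp add: ising_energy_def a_def inner_axis' matrix_vector_mul_component
          inner_axis)
    then have E: "ising_energy S (x + a) + ising_energy S (x - a) = 2 * ising_energy S x"
      by (simp add: ising_energy_def matrix_vector_right_distrib matrix_vector_mult_diff_distrib
          inner_add_left inner_add_right inner_diff_left inner_diff_right algebra_simps)
    define W where "W y = (\<Sum>j\<in>UNIV. ((y $ j)\<^sup>2 - c)\<^sup>2 / 4)" for y :: "real ^ 'n"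
    have "W (x + a) + W (x - a)
      = (\<Sum>j\<in>UNIV. 2 * (((x $ j)\<^sup>2 - c)\<^sup>2 / 4) + (if j = i then t^4/2 - c * t\<^sup>2 else 0))"
      unfolding W_def sum.distrib[symmetric]
      by (intro sum.cong)
        (auto simp: a_def axis_def xi power2_eq_square power4_eq_xxxx field_simps)
    also have "\<dots> = 2 * W x + (t^4/2 - c * t\<^sup>2)"
      by (simp add: W_def sum.distrib sum_distrib_left)
    finally show ?thesis
      unfolding potential_double_well c_def[symmetric] W_def[symmetric]
      using E by (simp add: algebra_simps)
  qed
  moreover have "t^4/2 < c * t\<^sup>2"
  proof -
    have "t^4 \<le> c * t\<^sup>2"
      using mult_right_mono[OF t2, of "t\<^sup>2"] by (simp flip: power_add)
    moreover have "c * t\<^sup>2 > 0" using t \<open>c > 0\<close> by simp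
    ultimately show ?thesis by linarith
  qed
  ultimately show False by linarith
qed

section \<open>Energy estimate and local minima in one orthant\<close>

text \<open>In the orthant of \<open>s\<close>, \<open>(x $ i)\<^sup>2 - r\<^sup>2\<close> factors
  as \<open>x $ i * s $ i + r\<close>, which is at least \<open>r\<close>, times
  \<open>x $ i * s $ i - r\<close>, whose modulus is that of \<open>d $ i\<close>. So the wells give
  \<open>r\<^sup>2 / 4\<close> times the squared norm of \<open>d\<close>. Half of this absorbs the
  energy of \<open>d\<close>, by \<open>4 * B \<le> r\<^sup>2\<close>; the cross term is linear in
  \<open>d\<close>.\<close>

lemma potential_orthant_lower_bound:
  fixes S :: "real ^ 'n ^ 'n"
  assumes sym: "transpose S = S"
    and B: "\<And>x. norm (S *v x) \<le> B * norm x"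
    and r: "r \<ge> 0" "r\<^sup>2 = \<alpha>\<^sup>2 - \<beta>" "4 * B \<le> r\<^sup>2"
    and s: "s \<in> spin_vectors" and pos: "\<And>i. x $ i * s $ i \<ge> 0"
    and d: "d = x - r *\<^sub>R s"
  shows "potential \<beta> \<alpha> S x \<ge>
    potential \<beta> \<alpha> S (r *\<^sub>R s) + r\<^sup>2 / 8 * (norm d)\<^sup>2 - B * CARD('n) * r * norm d"
proof -
  have "0 \<le> B * norm s" using order_trans[OF norm_ge_zero B] .
  have "s \<noteq> 0" using abs_spin_vector[OF s] by fastforce
  then have "B \<ge> 0" using \<open>0 \<le> B * norm s\<close> by (simp add: zero_le_mult_iff)
  have well: "((x $ i)\<^sup>2 - r\<^sup>2)\<^sup>2 \<ge> r\<^sup>2 * (d $ i)\<^sup>2" for i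
  proof -
    have s1: "s $ i = 1 \<or> s $ i = -1" using s by (auto simp: spin_vectors_iff)
    have "((x $ i)\<^sup>2 - r\<^sup>2)\<^sup>2 = (x $ i * s $ i + r)\<^sup>2 * (d $ i)\<^sup>2"
      using s1 by (auto simp: d power2_eq_square algebra_simps)
    moreover have "r\<^sup>2 \<le> (x $ i * s $ i + r)\<^sup>2"
      using pos[of i] r by (intro power_mono) auto
    ultimately show ?thesis by (simp add: mult_right_mono)
  qed
  have "(norm d)\<^sup>2 = (\<Sum>i\<in>UNIV. (d $ i)\<^sup>2)"
    unfolding power2_norm_eq_inner by (simp add: inner_vec_def power2_eq_square)
  then have wells: "(\<Sum>i\<in>UNIV. ((x $ i)\<^sup>2 - r\<^sup>2)\<^sup>2 / 4) \<ge> r\<^sup>2 / 4 * (norm d)\<^sup>2"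
    unfolding sum_distrib_left using well
    by (auto simp: sum_distrib_left intro!: sum_mono)
  have wells0: "(\<Sum>i\<in>UNIV. (((r *\<^sub>R s) $ i)\<^sup>2 - r\<^sup>2)\<^sup>2 / 4) = 0"
    using s by (intro sum.neutral) (auto simp: spin_vector_square power_mult_distrib)
  have "ising_energy S x = ising_energy S (r *\<^sub>R s + d)" by (simp add: d)
  also have "\<dots> = ising_energy S (r *\<^sub>R s) + ising_energy S d - r * (s \<bullet> (S *v d))"
    by (simp add: ising_energy_add[OF sym])
  finally have E: "ising_energy S x =
    ising_energy S (r *\<^sub>R s) + ising_energy S d - r * (s \<bullet> (S *v d))" .
  have "d \<bullet> (S *v d) \<le> norm d * (B * norm d)"
    using norm_cauchy_schwarz[of d "S *v d"] B[of d]
    by (meson mult_left_mono norm_ge_zero order_trans)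
  also have "\<dots> = B * (norm d)\<^sup>2" by (simp add: power2_eq_square)
  also have "\<dots> \<le> r\<^sup>2 / 4 * (norm d)\<^sup>2" using r by (intro mult_right_mono) auto
  finally have Ed: "ising_energy S d \<ge> - (r\<^sup>2 / 8 * (norm d)\<^sup>2)" by (simp add: ising_energy_def)
  have "s \<bullet> (S *v d) \<le> norm s * norm (S *v d)" by (rule norm_cauchy_schwarz)
  also have "\<dots> \<le> CARD('n) * (B * norm d)"
    using norm_spin_vector_le[OF s] B by (intro mult_mono) auto
  finally have "r * (s \<bullet> (S *v d)) \<le> r * (CARD('n) * (B * norm d))"
    using r by (intro mult_left_mono) auto
  then have "r * (s \<bullet> (S *v d)) \<le> B * CARD('n) * r * norm d" by (simp add: mult_ac)
  then show ?thesis
    using wells Ed unfolding potential_double_well r(2)[symmetric] E wells0 by linarith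
qed

lemma global_imp_local_min_point: "global_min_point f x \<Longrightarrow> local_min_point f x"
  by (auto simp: global_min_point_def local_min_point_def is_arg_min_linorder)

text \<open>A minimum over the closed ball of radius \<open>r/2\<close> about
  \<open>r *\<^sub>R s\<close> exists by compactness. On the bounding sphere the potential exceeds
  its value at the centre, so the minimum is interior, hence local; the whole ball lies in the open
  orthant of \<open>s\<close>.\<close>

lemma potential_local_min_in_orthant:
  fixes S :: "real ^ 'n ^ 'n"
  assumes sym: "transpose S = S"
    and B: "\<And>x. norm (S *v x) \<le> B * norm x"
    and r: "r > 0" "r\<^sup>2 = \<alpha>\<^sup>2 - \<beta>" "4 * B \<le> r\<^sup>2" "16 * B * CARD('n) < r\<^sup>2"
    and s: "s \<in> spin_vectors"
  obtains x where "local_min_point (potential \<beta> \<alpha> S) x" "sgn_vec x = s"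
proof -
  let ?U = "potential \<beta> \<alpha> S" and ?C = "cball (r *\<^sub>R s) (r/2)"
  have s1: "s $ i = 1 \<or> s $ i = -1" for i using s by (auto simp: spin_vectors_iff)
  have near: "x $ i * s $ i > 0" if "x \<in> ?C" for x i
  proof -
    have "\<bar>(r *\<^sub>R s - x) $ i\<bar> \<le> r/2"
      using that component_le_norm_cart[of "r *\<^sub>R s - x" i] by (simp add: dist_norm)
    then show ?thesis using s1[of i] r(1) by (auto simp: abs_real_def split: if_splits)
  qed
  have "continuous_on ?C ?U"
    unfolding potential_def by (intro continuous_intros
        linear_continuous_on matrix_vector_mul_bounded_linear)
  moreover have "?C \<noteq> {}" using r by simp
  ultimately obtain x where x: "x \<in> ?C" and min: "\<And>y. y \<in> ?C \<Longrightarrow> ?U x \<le> ?U y"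
    using continuous_attains_inf[of ?C ?U] compact_cball by blast
  have "dist (r *\<^sub>R s) x \<noteq> r/2"
  proof
    assume bd: "dist (r *\<^sub>R s) x = r/2"
    then have "norm (x - r *\<^sub>R s) = r/2" by (simp add: dist_norm norm_minus_commute)
    then have "?U x \<ge> ?U (r *\<^sub>R s) + r\<^sup>2 / 8 * (r/2)\<^sup>2 - B * CARD('n) * r * (r/2)"
      using potential_orthant_lower_bound[OF sym B _ r(2,3) s _ refl, of x] near[OF x] r(1)
      by (metis less_imp_le)
    \<comment> \<open>This factorization is the source of the constant 16 in the hypothesis on
      \<open>r\<close>.\<close>
    moreover have "r\<^sup>2 / 8 * (r/2)\<^sup>2 - B * CARD('n) * r * (r/2) = r\<^sup>2 / 32 * (r\<^sup>2 - 16 * B * CARD('n))"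
      by (simp add: power2_eq_square algebra_simps)
    moreover have "\<dots> > 0" using r(1,4) by (intro mult_pos_pos) auto
    moreover have "?U x \<le> ?U (r *\<^sub>R s)" using r by (intro min) simp
    ultimately show False by linarith
  qed
  with x have "x \<in> ball (r *\<^sub>R s) (r/2)" by simp
  then have "local_min_point ?U x"
    unfolding local_min_point_def eventually_nhds
    by (intro exI[of _ "ball (r *\<^sub>R s) (r/2)"]) (auto intro!: min)
  moreover have "sgn_vec x $ i = s $ i" for i
    using near[OF x, of i] s1[of i] by (auto simp: sgn_vec_def)
  then have "sgn_vec x = s" by (simp add: vec_eq_iff)
  ultimately show thesis by (rule that)
qed

section \<open>Signs of global minima\<close>

text \<open>If \<open>v\<close> had lower energy than \<open>s = sgn_vec x\<close>, moving from
  \<open>r *\<^sub>R s\<close> to \<open>r *\<^sub>R v\<close> would lower the potential by at least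
  \<open>r\<^sup>2 * \<gamma>\<close>, whereas moving from \<open>r *\<^sub>R s\<close> to
  \<open>x\<close> lowers it by at most \<open>2 * K\<^sup>2\<close>. For large \<open>r\<close>
  this contradicts the minimality of \<open>x\<close>.\<close>

lemma sgn_global_min_ising:
  fixes S :: "real ^ 'n ^ 'n"
  assumes sym: "transpose S = S" and diag: "\<And>i. S $ i $ i = 0"
    and B: "\<And>x. norm (S *v x) \<le> B * norm x"
    and r: "r > 0" "r\<^sup>2 = \<alpha>\<^sup>2 - \<beta>" "4 * B \<le> r\<^sup>2"
    and gap: "\<And>s v. s \<in> spin_vectors \<Longrightarrow> v \<in> spin_vectors \<Longrightarrow>
      ising_energy S v < ising_energy S s \<Longrightarrow> \<gamma> \<le> ising_energy S s - ising_energy S v"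
    and large: "2 * (B * CARD('n))\<^sup>2 < r\<^sup>2 * \<gamma>"
    and min: "global_min_point (potential \<beta> \<alpha> S) x"
  shows "is_arg_min (ising_energy S) (\<lambda>v. v \<in> spin_vectors) (sgn_vec x)"
proof -
  define K where "K = B * CARD('n)"
  define s where "s = sgn_vec x"
  have c: "\<alpha>\<^sup>2 > \<beta>" using r by (metis diff_gt_0_iff_gt zero_less_power)
  have s: "s \<in> spin_vectors"
    unfolding s_def
    using local_min_point_coord_nonzero[OF diag c global_imp_local_min_point[OF min]]
    by (rule sgn_vec_in_spin_vectors)
  have pos: "x $ i * s $ i \<ge> 0" for i by (simp add: s_def sgn_vec_def sgn_real_def)
  have "ising_energy S s \<le> ising_energy S v" if v: "v \<in> spin_vectors" for v
  proof (rule ccontr)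
    assume "\<not> ising_energy S s \<le> ising_energy S v"
    then have "\<gamma> \<le> ising_energy S s - ising_energy S v" using gap[OF s v] by simp
    then have \<gamma>: "r\<^sup>2 * \<gamma> \<le> r\<^sup>2 * (ising_energy S s - ising_energy S v)"
      by (rule mult_left_mono) simp
    have U: "potential \<beta> \<alpha> S (r *\<^sub>R u) = - real CARD('n) * (r\<^sup>2)\<^sup>2 / 4 + r\<^sup>2 * ising_energy S u"
      if "u \<in> spin_vectors" for u
    proof -
      have "(\<Sum>i\<in>UNIV. (((r *\<^sub>R u) $ i)\<^sup>2 - r\<^sup>2)\<^sup>2 / 4) = 0"
        using that by (intro sum.neutral) (auto simp: spin_vector_square power_mult_distrib)
      then show ?thesis
        by (simp add: potential_double_well ising_energy_scaleR flip: r(2))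
    qed
    define d where "d = x - r *\<^sub>R s"
    have "potential \<beta> \<alpha> S x \<ge>
        potential \<beta> \<alpha> S (r *\<^sub>R s) + r\<^sup>2 / 8 * (norm d)\<^sup>2 - K * r * norm d"
      unfolding K_def
      using potential_orthant_lower_bound[OF sym B _ r(2,3) s pos d_def] r(1) by simp
    moreover have "potential \<beta> \<alpha> S x \<le> potential \<beta> \<alpha> S (r *\<^sub>R v)"
      using min by (simp add: global_min_point_def is_arg_min_linorder)
    \<comment> \<open>Completing the square bounds the loss uniformly in \<open>d\<close> and
      \<open>r\<close>, so no estimate on the position of \<open>x\<close> is required.\<close>
    moreover have "r\<^sup>2 / 8 * (norm d)\<^sup>2 - K * r * norm d = (r * norm d - 4 * K)\<^sup>2 / 8 - 2 * K\<^sup>2"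
      by (simp add: power2_eq_square field_simps)
    moreover have "(r * norm d - 4 * K)\<^sup>2 \<ge> 0" by simp
    ultimately have "r\<^sup>2 * ising_energy S s - 2 * K\<^sup>2 \<le> r\<^sup>2 * ising_energy S v"
      unfolding U[OF s] U[OF v] by linarith
    then show False using \<gamma> large unfolding K_def by (simp add: right_diff_distrib)
  qed
  then show ?thesis using s by (simp add: is_arg_min_linorder s_def)
qed

section \<open>Choice of the threshold\<close>

lemma finite_positive_gap:
  fixes f :: "'a \<Rightarrow> real"
  assumes "finite A"
  obtains \<gamma> where "\<gamma> > 0"
    "\<And>s v. s \<in> A \<Longrightarrow> v \<in> A \<Longrightarrow> f v < f s \<Longrightarrow> \<gamma> \<le> f s - f v"
proof -
  \<comment> \<open>Inserting 1 keeps \<open>G\<close> nonempty when \<open>f\<close> is constant on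
    \<open>A\<close>.\<close>
  define G where "G = insert 1 {g \<in> (\<lambda>(s, v). f s - f v) ` (A \<times> A). g > 0}"
  have "finite G" using assms by (simp add: G_def)
  moreover from this have "Min G \<in> G" by (intro Min_in) (auto simp: G_def)
  then have "Min G > 0" by (auto simp: G_def)
  ultimately show thesis
    by (intro that[of "Min G"]) (auto intro!: Min_le simp: G_def)
qed

lemma admissible_threshold_exists:
  fixes S :: "real ^ 'n ^ 'n"
  assumes sym: "transpose S = S" and diag: "\<And>i. S $ i $ i = 0" and "\<beta> > 0"
  obtains \<alpha>0 where "admissible_threshold \<beta> S \<alpha>0"
proof -
  obtain B where "B > 0" and B: "\<And>x. norm (S *v x) \<le> B * norm x"
    using bounded_linear.pos_bounded[OF matrix_vector_mul_bounded_linear[of S]]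
    by (auto simp: mult.commute)
  obtain \<gamma> where "\<gamma> > 0" and gap: "\<And>s v. s \<in> spin_vectors \<Longrightarrow> v \<in> spin_vectors \<Longrightarrow>
      ising_energy S v < ising_energy S s \<Longrightarrow> \<gamma> \<le> ising_energy S s - ising_energy S v"
    using finite_positive_gap[OF finite_spin_vectors, of "ising_energy S"] by metis
  \<comment> \<open>The sum dominates both lower bounds required of \<open>r\<^sup>2\<close>: one
    for interior minima, one for the energy gap. Since the dimension is at least 1, it also
    dominates \<open>4 * B\<close>.\<close>
  define c0 where "c0 = 16 * B * CARD('n) + 2 * (B * CARD('n))\<^sup>2 / \<gamma>"
  have card: "real CARD('n) \<ge> 1" by (simp add: Suc_leI)
  have "2 * (B * CARD('n))\<^sup>2 / \<gamma> \<ge> 0" using \<open>\<gamma> > 0\<close> by simp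
  moreover have "4 * B \<le> 16 * B * CARD('n)"
    using mult_mono[of "4 * B" "16 * B" 1 "real CARD('n)"] card \<open>B > 0\<close> by linarith
  moreover have "16 * B * CARD('n) \<ge> 0" using \<open>B > 0\<close> by simp
  ultimately have c0: "c0 \<ge> 4 * B" "c0 \<ge> 16 * B * CARD('n)" "c0 \<ge> 2 * (B * CARD('n))\<^sup>2 / \<gamma>"
    unfolding c0_def by linarith+
  then have "c0 > 0" using \<open>B > 0\<close> by linarith
  \<comment> \<open>Beyond this threshold, \<open>r\<^sup>2 = \<alpha>\<^sup>2 - \<beta>\<close>
    exceeds \<open>c0\<close>.\<close>
  have "admissible_threshold \<beta> S (sqrt (c0 + \<beta>))"
    unfolding admissible_threshold_def
  proof (intro conjI allI impI)
    show "sqrt (c0 + \<beta>) > 0" using \<open>c0 > 0\<close> \<open>\<beta> > 0\<close> by simp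
  next
    fix \<alpha> :: real assume "\<alpha> > sqrt (c0 + \<beta>)"
    then have "c0 + \<beta> < \<alpha>\<^sup>2"
      using \<open>c0 > 0\<close> \<open>\<beta> > 0\<close> by (meson not_le real_le_rsqrt)
    define r where "r = sqrt (\<alpha>\<^sup>2 - \<beta>)"
    have r: "r > 0" "r\<^sup>2 = \<alpha>\<^sup>2 - \<beta>" and rc: "r\<^sup>2 > c0"
      using \<open>c0 + \<beta> < \<alpha>\<^sup>2\<close> \<open>c0 > 0\<close> by (auto simp: r_def)
    have large: "4 * B \<le> r\<^sup>2" "16 * B * CARD('n) < r\<^sup>2" using rc c0 by linarith+
    have gap_large: "2 * (B * CARD('n))\<^sup>2 < r\<^sup>2 * \<gamma>"
      using rc c0(3) \<open>\<gamma> > 0\<close> by (simp flip: pos_divide_less_eq)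
    have "\<alpha>\<^sup>2 > \<beta>" using \<open>c0 + \<beta> < \<alpha>\<^sup>2\<close> \<open>c0 > 0\<close> by linarith
    show "sgn_vec ` {x. local_min_point (potential \<beta> \<alpha> S) x} = spin_vectors"
    proof (intro equalityI subsetI)
      fix v assume "v \<in> sgn_vec ` {x. local_min_point (potential \<beta> \<alpha> S) x}"
      then show "v \<in> spin_vectors"
        using local_min_point_coord_nonzero[OF diag \<open>\<alpha>\<^sup>2 > \<beta>\<close>] sgn_vec_in_spin_vectors by blast
    next
      fix v :: "real ^ 'n" assume "v \<in> spin_vectors"
      then show "v \<in> sgn_vec ` {x. local_min_point (potential \<beta> \<alpha> S) x}"
        using potential_local_min_in_orthant[OF sym B r large] by (metis imageI mem_Collect_eq)
    qed
    fix x assume "global_min_point (potential \<beta> \<alpha> S) x"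
    then show "is_arg_min (ising_energy S) (\<lambda>v. v \<in> spin_vectors) (sgn_vec x)"
      by (intro sgn_global_min_ising[OF sym diag B r large(1) _ gap_large] gap)
  qed
  then show thesis by (rule that)
qed

section \<open>Transfer to \<open>potential_c\<close>\<close>

text \<open>The factor 2 in the coupling offsets the 1/2 in front of the quadratic form, and
  \<open>p \<ge> 0\<close> lets \<open>sqrt p\<close> serve as \<open>\<alpha>\<close>.\<close>

lemma potential_c_eq_potential:
  assumes "p \<ge> 0"
  shows "potential_c \<epsilon> p S = potential 1 (sqrt p) ((2 * \<epsilon>) *\<^sub>R S)"
  using assms
  by (simp add: fun_eq_iff potential_c_def potential_def inner_vec_def sum.distrib
      sum_distrib_left scaleR_matrix_vector_assoc[symmetric] power2_eq_square mult_ac)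

theorem proposition3p3:
  fixes S\<^sub>c :: "real ^ 'n ^ 'n" and \<epsilon> :: real
  assumes "transpose S\<^sub>c = S\<^sub>c"
    and "\<And>i. S\<^sub>c $ i $ i = 0"
    and "0 < \<epsilon>" and "\<epsilon> < 1"
  shows "\<exists>\<alpha>0. admissible_threshold 1 ((2 * \<epsilon>) *\<^sub>R S\<^sub>c) \<alpha>0 \<and>
           (\<forall>p>0. p > \<alpha>0\<^sup>2 \<longrightarrow>
              (\<forall>x. global_min_point (potential_c \<epsilon> p S\<^sub>c) x \<longrightarrow>
                   is_arg_min (ising_energy S\<^sub>c) (\<lambda>v. v \<in> spin_vectors) (sgn_vec x)))"
proof -
  have "transpose ((2 * \<epsilon>) *\<^sub>R S\<^sub>c) = (2 * \<epsilon>) *\<^sub>R S\<^sub>c"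
    using assms(1) by (simp add: transpose_def vec_eq_iff)
  then obtain \<alpha>0 where \<alpha>0: "admissible_threshold 1 ((2 * \<epsilon>) *\<^sub>R S\<^sub>c) \<alpha>0"
    using admissible_threshold_exists[of "(2 * \<epsilon>) *\<^sub>R S\<^sub>c" 1] assms(2) by auto
  have "is_arg_min (ising_energy S\<^sub>c) (\<lambda>v. v \<in> spin_vectors) (sgn_vec x)"
    if p: "p > 0" "p > \<alpha>0\<^sup>2" and min: "global_min_point (potential_c \<epsilon> p S\<^sub>c) x" for p x
  proof -
    have "sqrt p > \<alpha>0" using p by (simp add: real_less_rsqrt)
    then have "is_arg_min (ising_energy ((2 * \<epsilon>) *\<^sub>R S\<^sub>c)) (\<lambda>v. v \<in> spin_vectors) (sgn_vec x)"
      using \<alpha>0 min p by (simp add: admissible_threshold_def potential_c_eq_potential)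
    \<comment> \<open>Scaling the coupling by \<open>2 * \<epsilon> > 0\<close> scales all energies
      alike and preserves the minimizers.\<close>
    then show ?thesis
      using \<open>0 < \<epsilon>\<close> by (simp add: is_arg_min_linorder ising_energy_scaleR_left)
  qed
  with \<alpha>0 show ?thesis by blast
qed

end
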